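(* Let $n,m$ be positive integers, and for $u,v$ positive integers or $\infty$ let $r_{u,v}(n,m)$ be the number of Rota-Baxter words of degree $n$ and arity $m$ in the set $R_{u,v}$ of Rota-Baxter words with one generator $x$ of exponent $v$ and one operator $P$ of exponent $u$. Then: (1) For $1\le u\le\infty$, $\displaystyle r_{u,1}(n,m)=\sum_{k=1}^n g(n,k,u)\,r_{1,1}(k,m)$. (2) For $1\le v\le\infty$, $\displaystyle r_{1,v}(n,m)=\sum_{\ell=1}^m g(m,\ell,v)\,r_{1,1}(n,\ell)$. (3) For $1\le u,v\le\infty$, $r_{u,v}(n,m)$ is equal to each of the three expressions (a) $\displaystyle\sum_{\ell=1}^m g(m,\ell,v)\,r_{u,1}(n,\ell)$, (b) $\displaystyle\sum_{k=1}^n g(n,k,u)\,r_{1,v}(k,m)$, (c) $\displaystyle\sum_{k=1}^n\sum_{\ell=1}^m g(n,k,u)\,g(m,\ell,v)\,r_{1,1}(k,\ell)$.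
   Context: A Rota-Baxter word (in one generator $x$ and one operator $P=\lfloor\ \rfloor$) is either the empty word $\emptyset$ or a nonempty finite string over $x,\lfloor,\rfloor$ such that the brackets are balanced (equally many $\lfloor$ and $\rfloor$, every prefix having at least as many $\lfloor$ as $\rfloor$) and neither $\rfloor\lfloor$ nor $\lfloor\rfloor$ occurs as a substring. The degree of a word is its number of matched pairs of brackets; its arity is the number of $x$'s in it, counted with multiplicity. An $x$-run in a word is a maximal block of consecutive $x$'s (written $x^\nu$, $\nu$ being its length). A $P$-run is a maximal chain of immediately nested matched pairs of brackets (a pair is immediately nested in another if the content of the outer pair is exactly the inner pair together with its content); its length is the number of pairs in the chain. For $u,v$ positive integers or $\infty$, $R_{u,v}$ is the set of Rota-Baxter words in which every $P$-run has length $\le u$ and every $x$-run has length $\le v$. For positive integers $m,\ell$ and $v$ a positive integer or $\infty$, $g(m,\ell,v)$ denotes the number of compositions of $m$ into $\ell$ positive integer parts (ordered tuples of positive integers with sum $m$) with each part at most $v$ (no restriction if $v=\infty$). *)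

theory Defs
  imports Main "HOL-Library.Sublist" "HOL-Library.Extended_Nat"
begin

datatype letter = X | Open | Close

definition balanced :: "letter list \<Rightarrow> bool" where
  "balanced w \<longleftrightarrow> count_list w Open = count_list w Close \<and>
     (\<forall>p. prefix p w \<longrightarrow> count_list p Close \<le> count_list p Open)"

text \<open>The predicate \<open>sublist\<close> is contiguous containment. The empty word is included.\<close>

definition rb_word :: "letter list \<Rightarrow> bool" where
  "rb_word w \<longleftrightarrow> balanced w \<and> \<not> sublist [Close, Open] w \<and> \<not> sublist [Open, Close] w"

text \<open>A matched pair is given by the positions of its two brackets; they match when the
  string strictly between them is balanced.\<close>

definition matched_pairs :: "letter list \<Rightarrow> (nat \<times> nat) set" where
  "matched_pairs w = {(i, j). i < j \<and> j < length w \<and> w ! i = Open \<and> w ! j = Close \<and>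
     balanced (take (j - Suc i) (drop (Suc i) w))}"

definition degree :: "letter list \<Rightarrow> nat" where
  "degree w = card (matched_pairs w)"

definition arity :: "letter list \<Rightarrow> nat" where
  "arity w = count_list w X"

text \<open>An x-run of length \<open>k\<close> is presented by the parts \<open>p\<close>, \<open>s\<close> of the word before and after it.\<close>

definition x_run :: "letter list \<Rightarrow> letter list \<Rightarrow> nat \<Rightarrow> letter list \<Rightarrow> bool" where
  "x_run w p k s \<longleftrightarrow> 0 < k \<and> w = p @ replicate k X @ s \<and>
     (p \<noteq> [] \<longrightarrow> last p \<noteq> X) \<and> (s \<noteq> [] \<longrightarrow> hd s \<noteq> X)"

text \<open>The positions strictly inside the outer pair are exactly those of the inner pair
  together with its content.\<close>

definition immediately_nested :: "nat \<times> nat \<Rightarrow> nat \<times> nat \<Rightarrow> bool" where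
  "immediately_nested inner outer \<longleftrightarrow> {fst outer<..<snd outer} = {fst inner..snd inner}"

text \<open>Chains are listed from the outermost pair to the innermost one.\<close>

definition p_chain :: "letter list \<Rightarrow> (nat \<times> nat) list \<Rightarrow> bool" where
  "p_chain w c \<longleftrightarrow> c \<noteq> [] \<and> set c \<subseteq> matched_pairs w \<and>
     successively (\<lambda>outer inner. immediately_nested inner outer) c"

definition p_run :: "letter list \<Rightarrow> (nat \<times> nat) list \<Rightarrow> bool" where
  "p_run w c \<longleftrightarrow> p_chain w c \<and> (\<forall>d. p_chain w d \<and> sublist c d \<longrightarrow> d = c)"

definition RB :: "enat \<Rightarrow> enat \<Rightarrow> letter list set" where
  "RB u v = {w. rb_word w \<and> (\<forall>c. p_run w c \<longrightarrow> enat (length c) \<le> u) \<and>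
     (\<forall>p k s. x_run w p k s \<longrightarrow> enat k \<le> v)}"

definition r :: "enat \<Rightarrow> enat \<Rightarrow> nat \<Rightarrow> nat \<Rightarrow> nat" where
  "r u v n m = card {w \<in> RB u v. degree w = n \<and> arity w = m}"

definition g :: "nat \<Rightarrow> nat \<Rightarrow> enat \<Rightarrow> nat" where
  "g m l v = card {a :: nat list. length a = l \<and> sum_list a = m \<and>
     (\<forall>i \<in> set a. 0 < i \<and> enat i \<le> v)}"

end

theory Submission
  imports Defs
begin

text \<open>Stretching a Rota-Baxter word means replacing each x-run and each P-run by a run of some other
  positive length. This changes neither the arrangement of the runs nor their number, so a word
  of \<open>R\<^bsub>u,v\<^esub>\<close> is the same thing as three independent data: a word with all runs of length one
  (of degree \<open>k\<close> and arity \<open>l\<close>, say), a composition of the degree \<open>n\<close> into \<open>k\<close> parts at most \<open>u\<close>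
  giving the lengths of the P-runs, and a composition of the arity \<open>m\<close> into \<open>l\<close> parts at
  most \<open>v\<close> giving the lengths of the x-runs. Counting these data is the double sum
  \<open>r_eq_double_sum\<close>. The other formulas are consequences of it: \<open>m\<close> has a composition into \<open>l\<close>
  parts equal to one only if \<open>m = l\<close>, so the double sum collapses to a single sum when
  \<open>u = 1\<close> or \<open>v = 1\<close>; recognising these single sums inside the double sum expresses
  \<open>r u v\<close> through \<open>r u 1\<close> and through \<open>r 1 v\<close>.

  To make the arrangement of runs explicit, words are parsed into trees whose nodes are the runs,
  labelled by their lengths. Every Rota-Baxter word has exactly one such tree
  (\<open>rb_word_has_tree\<close>, \<open>word_inj\<close>); degree and arity are the sums of the two kinds of labels
  (\<open>degree_word\<close>, \<open>arity_word\<close>), and the conditions defining \<open>R\<^bsub>u,v\<^esub>\<close> are bounds on the labels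
  (\<open>word_in_RB_iff\<close>). The last of these needs the most care: a chain of nested pairs in the
  string, wherever it lies, must be found inside a single node of the tree.\<close>

section \<open>Balanced words\<close>

lemma balanced_prefix: "balanced (p @ q) \<Longrightarrow> count_list p Close \<le> count_list p Open"
  by (simp add: balanced_def)

lemma balanced_Nil [simp]: "balanced []"
  by (simp add: balanced_def)

lemma balanced_append:
  assumes "balanced a" "balanced b"
  shows "balanced (a @ b)"
  using assms by (auto simp: balanced_def prefix_append)

lemma balanced_append_cancel:
  assumes "balanced a" "balanced (a @ b)"
  shows "balanced b"
  unfolding balanced_def
proof (intro conjI allI impI)
  show "count_list b Open = count_list b Close"
    using assms by (simp add: balanced_def)
next
  fix p assume "prefix p b"
  then have "prefix (a @ p) (a @ b)" by simp
  then have "count_list (a @ p) Close \<le> count_list (a @ p) Open"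
    using assms(2) unfolding balanced_def by blast
  then show "count_list p Close \<le> count_list p Open"
    using assms(1) by (simp add: balanced_def)
qed

lemma balanced_bracket:
  assumes "balanced a"
  shows "balanced (Open # a @ [Close])"
  using assms by (auto simp: balanced_def prefix_Cons prefix_append)

lemma balanced_X: "balanced (X # w) \<longleftrightarrow> balanced w"
  by (auto simp: balanced_def prefix_Cons)

lemma not_balanced_Close: "\<not> balanced (Close # w)"
  using balanced_prefix[of "[Close]" w] by auto

lemma not_balanced_Open_last: "\<not> balanced (w @ [Open])"
  using balanced_prefix[of w "[Open]"] by (auto simp: balanced_def)

lemma balanced_replicate:
  "balanced z \<Longrightarrow> balanced (replicate k Open @ z @ replicate k Close)"
proof (induction k)
  case (Suc k)
  have "replicate (Suc k) Open @ z @ replicate (Suc k) Close =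
    Open # (replicate k Open @ z @ replicate k Close) @ [Close]"
    by (simp add: replicate_append_same)
  with Suc show ?case by (metis balanced_bracket)
qed simp

text \<open>The shortest prefix with more closing than opening brackets ends in a closing bracket,
  and what precedes that bracket is balanced.\<close>

lemma first_close:
  assumes "count_list q Open < count_list q Close"
  obtains z s where "q = z @ Close # s" "balanced z"
proof -
  let ?P = "\<lambda>i. count_list (take i q) Open < count_list (take i q) Close"
  define i where "i = (LEAST i. ?P i)"
  have ex: "?P (length q)" using assms by simp
  have i: "?P i" unfolding i_def by (rule LeastI[of ?P, OF ex])
  have least: "\<not> ?P j" if "j < i" for j
    using that not_less_Least unfolding i_def by blast
  have le: "i \<le> length q" unfolding i_def by (rule Least_le[of ?P, OF ex])
  obtain j where j: "i = Suc j" using i by (cases i) auto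
  have jl: "j < length q" using le j by simp
  have split: "take i q = take j q @ [q ! j]" using j jl by (simp add: take_Suc_conv_app_nth)
  have nj: "\<not> ?P j" using least j by simp
  have Close: "q ! j = Close" using i nj split by (cases "q ! j") auto
  have "balanced (take j q)" unfolding balanced_def
  proof (intro conjI allI impI)
    show "count_list (take j q) Open = count_list (take j q) Close"
      using i nj split Close by auto
  next
    fix p assume "prefix p (take j q)"
    then obtain s where "take j q = p @ s" by (auto simp: prefix_def)
    then have "length p \<le> j" "p = take (length p) (take j q)"
      using jl by (metis length_append length_take le_add1 min.absorb2 less_imp_le, simp)
    then have "p = take (length p) q" "length p < i"
      using j by (simp_all add: min_def)
    then show "count_list p Close \<le> count_list p Open" using least by (metis leI)
  qed
  moreover have "q = take j q @ Close # drop (Suc j) q"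
    using Close jl by (metis id_take_nth_drop)
  ultimately show ?thesis using that by blast
qed

text \<open>Makes the first-letter decomposition below unambiguous: if one of \<open>z\<close>, \<open>z'\<close> were longer, it
  would have a prefix consisting of the other one and a surplus closing bracket.\<close>

lemma close_position_unique:
  assumes "z @ Close # s = z' @ Close # s'" "balanced z" "balanced z'"
  shows "z = z' \<and> s = s'"
proof -
  have no: False if "y' = y @ Close # t" "balanced y" "balanced y'" for y y' t
    using that balanced_prefix[of "y @ [Close]" t] by (simp add: balanced_def)
  from assms(1) obtain us where
    "z = z' @ us \<and> us @ Close # s = Close # s' \<or> z @ us = z' \<and> Close # s = us @ Close # s'"
    by (auto simp: append_eq_append_conv2)
  then show ?thesis
  proof
    assume "z = z' @ us \<and> us @ Close # s = Close # s'"
    then show ?thesis using no[of z z'] assms(2,3) by (cases us) auto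
  next
    assume "z @ us = z' \<and> Close # s = us @ Close # s'"
    then show ?thesis using no[of z' z] assms(2,3) by (cases us) auto
  qed
qed

lemma open_bracket_closes:
  assumes "balanced (p @ Open # q)"
  obtains z s where "q = z @ Close # s" "balanced z"
proof -
  have "count_list p Close \<le> count_list p Open"
    using balanced_prefix[OF assms] .
  moreover have "count_list (p @ Open # q) Open = count_list (p @ Open # q) Close"
    using assms by (simp add: balanced_def)
  ultimately have "count_list q Open < count_list q Close" by simp
  then show ?thesis using first_close that by blast
qed

text \<open>A nonempty balanced word starts with \<open>X\<close>, or with a bracket whose closing partner cuts
  the rest into two balanced words.\<close>

lemma balanced_induct [consumes 1, case_names Nil X Bracket]:
  assumes "balanced w"
    and "P []"
    and "\<And>w. balanced w \<Longrightarrow> P w \<Longrightarrow> P (X # w)"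
    and "\<And>z w. balanced z \<Longrightarrow> balanced w \<Longrightarrow> P z \<Longrightarrow> P w \<Longrightarrow> P (Open # z @ Close # w)"
  shows "P w"
  using assms(1)
proof (induction "length w" arbitrary: w rule: less_induct)
  case less
  show ?case
  proof (cases w)
    case Nil
    then show ?thesis using assms(2) by simp
  next
    case (Cons c q)
    show ?thesis
    proof (cases c)
      case X
      then show ?thesis using Cons less assms(3) by (auto simp: balanced_X)
    next
      case Open
      obtain z s where z: "q = z @ Close # s" "balanced z"
        using open_bracket_closes[of "[]" q] less.prems Cons Open by auto
      have w: "w = (Open # z @ [Close]) @ s" using Cons Open z by simp
      then have "balanced s"
        using balanced_append_cancel balanced_bracket z(2) less.prems by metis
      then show ?thesis using w z less(1)[of z] less(1)[of s] assms(4)[of z s] by auto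
    next
      case Close
      then show ?thesis using less.prems Cons not_balanced_Close by auto
    qed
  qed
qed

section \<open>Degree, P-runs and x-runs as properties of strings\<close>

lemma matched_pairs_iff:
  "(i, j) \<in> matched_pairs w \<longleftrightarrow>
    (\<exists>p z s. w = p @ Open # z @ Close # s \<and> balanced z \<and> i = length p \<and>
      j = Suc (length p + length z))"
proof
  assume "(i, j) \<in> matched_pairs w"
  then have h: "i < j" "j < length w" "w ! i = Open" "w ! j = Close"
    "balanced (take (j - Suc i) (drop (Suc i) w))"
    by (auto simp: matched_pairs_def)
  have "w = take i w @ Open # drop (Suc i) w"
    using h id_take_nth_drop[of i w] by simp
  moreover have "drop (Suc i) w = take (j - Suc i) (drop (Suc i) w) @ Close # drop (Suc j) w"
    using h id_take_nth_drop[of "j - Suc i" "drop (Suc i) w"] by simp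
  ultimately have "w = take i w @ Open # take (j - Suc i) (drop (Suc i) w) @ Close # drop (Suc j) w"
    by simp
  with h show "\<exists>p z s. w = p @ Open # z @ Close # s \<and> balanced z \<and> i = length p \<and>
      j = Suc (length p + length z)"
    by (intro exI[of _ "take i w"] exI[of _ "take (j - Suc i) (drop (Suc i) w)"]
        exI[of _ "drop (Suc j) w"]) auto
next
  assume "\<exists>p z s. w = p @ Open # z @ Close # s \<and> balanced z \<and> i = length p \<and>
      j = Suc (length p + length z)"
  then show "(i, j) \<in> matched_pairs w" by (auto simp: matched_pairs_def nth_append)
qed

lemma matched_pairsI:
  "w = p @ Open # z @ Close # s \<Longrightarrow> balanced z \<Longrightarrow>
    (length p, Suc (length p + length z)) \<in> matched_pairs w"
  unfolding matched_pairs_iff by blast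

text \<open>Every opening bracket has exactly one partner, so matched pairs correspond to the positions
  of opening brackets.\<close>

lemma degree_eq_count_Open:
  assumes "balanced w"
  shows "degree w = count_list w Open"
proof -
  let ?O = "{i. i < length w \<and> w ! i = Open}"
  have "bij_betw fst (matched_pairs w) ?O"
    unfolding bij_betw_def
  proof
    show "inj_on fst (matched_pairs w)"
    proof (rule inj_onI)
      fix a b assume ab: "a \<in> matched_pairs w" "b \<in> matched_pairs w" "fst a = fst b"
      obtain p z s where a: "w = p @ Open # z @ Close # s" "balanced z"
        "a = (length p, Suc (length p + length z))"
        using ab(1) by (cases a) (auto simp: matched_pairs_iff)
      obtain p' z' s' where b: "w = p' @ Open # z' @ Close # s'" "balanced z'"
        "b = (length p', Suc (length p' + length z'))"
        using ab(2) by (cases b) (auto simp: matched_pairs_iff)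
      have "length p = length p'" using ab(3) a(3) b(3) by simp
      with a(1) b(1) have "p = p'" "z @ Close # s = z' @ Close # s'"
        by (auto simp: append_eq_append_conv)
      with close_position_unique a(2,3) b(2,3) show "a = b" by metis
    qed
    show "fst ` matched_pairs w = ?O"
    proof
      show "fst ` matched_pairs w \<subseteq> ?O" by (auto simp: matched_pairs_def)
      show "?O \<subseteq> fst ` matched_pairs w"
      proof
        fix i assume "i \<in> ?O"
        then have i: "i < length w" and w: "w = take i w @ Open # drop (Suc i) w"
          using id_take_nth_drop[of i w] by auto
        obtain z s where "drop (Suc i) w = z @ Close # s" "balanced z"
          using open_bracket_closes assms w by metis
        with w i have "(i, Suc (i + length z)) \<in> matched_pairs w"
          using matched_pairsI[of w "take i w" z s] by (simp add: min_def)
        then show "i \<in> fst ` matched_pairs w" by force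
      qed
    qed
  qed
  then have "degree w = card ?O" unfolding degree_def by (rule bij_betw_same_card)
  then show ?thesis by (simp add: count_list_eq_length_filter length_filter_conv_card eq_commute)
qed

text \<open>The string form of a chain of \<open>k\<close> immediately nested pairs, free of positions: \<open>k\<close> adjacent
  opening brackets whose partners are \<open>k\<close> adjacent closing brackets.\<close>

definition nested :: "letter list \<Rightarrow> nat \<Rightarrow> bool" where
  "nested w k \<longleftrightarrow> (\<exists>p z s. balanced z \<and>
     w = p @ replicate k Open @ z @ replicate k Close @ s)"

lemma immediately_nested_iff:
  assumes "i < j" "i' < j'"
  shows "immediately_nested (i', j') (i, j) \<longleftrightarrow> i' = Suc i \<and> j = Suc j'"
proof -
  have "{i<..<j} = {Suc i..j - 1}" using assms by auto
  then show ?thesis using assms by (auto simp: immediately_nested_def Icc_eq_Icc)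
qed

lemma p_chain_Cons:
  "p_chain w (a # b # c) \<longleftrightarrow> a \<in> matched_pairs w \<and> immediately_nested b a \<and> p_chain w (b # c)"
  by (auto simp: p_chain_def)

lemma p_chain_imp_nested:
  assumes "p_chain w c"
  shows "nested w (length c)"
proof -
  \<comment> \<open>The induction keeps track of where the outermost pair lies, so that the next pair can be added
    around it.\<close>
  have "\<exists>p z s. balanced z \<and>
      w = p @ replicate (length c) Open @ z @ replicate (length c) Close @ s \<and>
      length p = fst (hd c) \<and> length w = Suc (snd (hd c)) + length s"
    using assms
  proof (induction c)
    case Nil
    then show ?case by (simp add: p_chain_def)
  next
    case (Cons a c)
    obtain i j where a: "a = (i, j)" by (cases a)
    have "(i, j) \<in> matched_pairs w" using Cons.prems a by (simp add: p_chain_def)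
    then obtain p z s where w: "w = p @ Open # z @ Close # s" "balanced z" "i = length p"
      "j = Suc (length p + length z)" by (auto simp: matched_pairs_iff)
    show ?case
    proof (cases c)
      case Nil
      then show ?thesis using w a by (intro exI[of _ p] exI[of _ z] exI[of _ s]) simp
    next
      case (Cons b c')
      obtain i' j' where b: "b = (i', j')" by (cases b)
      have b': "b \<in> matched_pairs w" "immediately_nested b a" and c: "p_chain w c"
        using Cons.prems Cons by (auto simp: p_chain_Cons) (auto simp: p_chain_def)
      have "i' < j'" using b' b by (simp add: matched_pairs_def)
      then have ij: "i' = Suc i" "j = Suc j'"
        using immediately_nested_iff[of i j i' j'] b' a b w by auto
      obtain p' z' s' where w': "balanced z'"
        "w = p' @ replicate (length c) Open @ z' @ replicate (length c) Close @ s'"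
        "length p' = Suc i" "length w = Suc j' + length s'"
        using Cons.IH[OF c] Cons b ij by auto
      let ?m = "replicate (length c) Open @ z' @ replicate (length c) Close"
      have "p @ Open # z @ Close # s = (p @ [Open]) @ (z @ Close # s)" by simp
      then have "(p @ [Open]) @ (z @ Close # s) = p' @ (?m @ s')"
        using w(1) w'(2) by simp
      then have p': "p' = p @ [Open]" and r: "z @ (Close # s) = ?m @ s'"
        using w(3) w'(3) append_eq_append_conv[of "p @ [Open]" p' "z @ (Close # s)" "?m @ s'"]
        by simp_all
      have "length (Close # s) = length s'"
        using w w'(4) ij by simp
      then have s': "s' = Close # s" using r by (metis append_eq_append_conv)
      show ?thesis
        using w' p' s' a w ij
        by (intro exI[of _ p] exI[of _ z'] exI[of _ s])
          (simp add: replicate_app_Cons_same)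
    qed
  qed
  then show ?thesis unfolding nested_def by blast
qed

lemma nested_imp_p_chain:
  assumes "balanced z" "w = p @ replicate (Suc k) Open @ z @ replicate (Suc k) Close @ s"
  shows "\<exists>c. p_chain w c \<and> length c = Suc k \<and>
    hd c = (length p, Suc (length p + (2 * k + length z)))"
  using assms(2)
proof (induction k arbitrary: p s)
  case 0
  then have "(length p, Suc (length p + length z)) \<in> matched_pairs w"
    using assms(1) by (auto simp: matched_pairs_iff)
  then show ?case by (intro exI[of _ "[(length p, Suc (length p + length z))]"])
      (simp add: p_chain_def)
next
  case (Suc k)
  have "w = (p @ [Open]) @ replicate (Suc k) Open @ z @ replicate (Suc k) Close @ (Close # s)"
    using Suc.prems by (simp add: replicate_app_Cons_same)
  from Suc.IH[OF this] obtain c where c: "p_chain w c" "length c = Suc k"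
    "hd c = (Suc (length p), Suc (Suc (length p + (2 * k + length z))))" by auto
  obtain b c' where bc: "c = b # c'" using c(2) by (cases c) auto
  let ?a = "(length p, Suc (length p + (2 * Suc k + length z)))"
  let ?m = "replicate (Suc k) Open @ z @ replicate (Suc k) Close"
  have "w = p @ Open # ?m @ Close # s"
    using Suc.prems by (simp add: replicate_app_Cons_same)
  then have "(length p, Suc (length p + length ?m)) \<in> matched_pairs w"
    by (rule matched_pairsI) (rule balanced_replicate[OF assms(1)])
  moreover have "length ?m = 2 * Suc k + length z" by simp
  ultimately have "?a \<in> matched_pairs w" by (simp only:)
  moreover have "immediately_nested b ?a"
    using c(3) bc by (simp add: immediately_nested_iff)
  ultimately have "p_chain w (?a # c)" using c(1) bc by (simp add: p_chain_Cons)
  then show ?case using c(2) by (intro exI[of _ "?a # c"]) simp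
qed

text \<open>Each chain is part of a maximal one, because a chain of length \<open>k\<close> occupies
  \<open>2 * k\<close> letters. Hence bounding the P-runs bounds all chains.\<close>

lemma p_runs_bounded_iff:
  "(\<forall>c. p_run w c \<longrightarrow> enat (length c) \<le> u) \<longleftrightarrow> (\<forall>k>0. nested w k \<longrightarrow> enat k \<le> u)"
proof (intro iffI allI impI)
  fix k :: nat
  assume u: "\<forall>c. p_run w c \<longrightarrow> enat (length c) \<le> u" and k: "0 < k" "nested w k"
  obtain k' where k': "k = Suc k'" using k by (cases k) auto
  obtain c where c: "p_chain w c" "length c = k"
    using nested_imp_p_chain k unfolding nested_def k' by metis
  let ?P = "\<lambda>d. p_chain w d \<and> sublist c d"
  have bound: "length d \<le> length w" if "p_chain w d" for d
    using p_chain_imp_nested[OF that] by (auto simp: nested_def)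
  then have "\<forall>d. ?P d \<longrightarrow> length d < Suc (length w)" by (auto simp: less_Suc_eq_le)
  then obtain d where d: "?P d" "\<forall>e. ?P e \<longrightarrow> length e \<le> length d"
    using ex_has_greatest_nat[of ?P c length "Suc (length w)"] c(1) by auto
  have "p_run w d" unfolding p_run_def
  proof (intro conjI allI impI)
    show "p_chain w d" using d by simp
    fix e assume e: "p_chain w e \<and> sublist d e"
    then have "sublist c e" using d(1) sublist_order.order_trans by blast
    then have "length e \<le> length d" using d(2) e by blast
    moreover obtain ps ss where "e = ps @ d @ ss" using e by (auto simp: sublist_def)
    ultimately show "e = d" by simp
  qed
  then have "enat (length d) \<le> u" using u by blast
  moreover have "k \<le> length d" using d(1) c(2) sublist_length_le by blast
  ultimately show "enat k \<le> u" by (meson enat_ord_simps(1) order_trans)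
next
  fix c assume u: "\<forall>k>0. nested w k \<longrightarrow> enat k \<le> u" and c: "p_run w c"
  then have "p_chain w c" "c \<noteq> []" by (auto simp: p_run_def p_chain_def)
  then show "enat (length c) \<le> u" using u p_chain_imp_nested by blast
qed

text \<open>Similarly for x-runs: a longest block of letters \<open>X\<close> cannot be extended and is an x-run.\<close>

lemma x_runs_bounded_iff:
  "(\<forall>p k s. x_run w p k s \<longrightarrow> enat k \<le> v) \<longleftrightarrow>
    (\<forall>k>0. sublist (replicate k X) w \<longrightarrow> enat k \<le> v)"
proof (intro iffI allI impI)
  fix k :: nat
  assume v: "\<forall>p k s. x_run w p k s \<longrightarrow> enat k \<le> v"
    and k: "0 < k" "sublist (replicate k X) w"
  let ?P = "\<lambda>k. 0 < k \<and> sublist (replicate k X) w"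
  have "\<forall>k. ?P k \<longrightarrow> k < Suc (length w)"
    by (metis le_imp_less_Suc length_replicate sublist_length_le)
  then obtain K where K: "?P K" "\<forall>k. ?P k \<longrightarrow> k \<le> K"
    using ex_has_greatest_nat[of ?P k "\<lambda>k. k" "Suc (length w)"] k by auto
  obtain p s where w: "w = p @ replicate K X @ s" using K(1) by (auto simp: sublist_def)
  \<comment> \<open>Another \<open>X\<close> next to the block would give a longer block.\<close>
  have nK: "\<not> sublist (replicate (Suc K) X) w" using K(2) by force
  have "x_run w p K s" unfolding x_run_def
  proof (intro conjI impI)
    show "last p \<noteq> X" if "p \<noteq> []"
    proof
      assume "last p = X"
      then have "p = butlast p @ [X]" using that by (metis append_butlast_last_id)
      then have "w = butlast p @ replicate (Suc K) X @ s" using w by (metis append.assoc append_Cons append_Nil replicate_Suc)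
      then show False using nK by (auto simp: sublist_def)
    qed
    show "hd s \<noteq> X" if "s \<noteq> []"
    proof
      assume "hd s = X"
      then have "s = X # tl s" using that by (metis list.collapse)
      then have "w = p @ replicate (Suc K) X @ tl s"
        using w by (metis replicate_app_Cons_same replicate_Suc append_Cons)
      then show False using nK by (auto simp: sublist_def)
    qed
  qed (use K w in auto)
  then have "enat K \<le> v" using v by blast
  moreover have "k \<le> K" using K k by blast
  ultimately show "enat k \<le> v" by (meson enat_ord_simps(1) order_trans)
next
  fix p k s
  assume "\<forall>k>0. sublist (replicate k X) w \<longrightarrow> enat k \<le> v" "x_run w p k s"
  then show "enat k \<le> v" by (auto simp: x_run_def)
qed

text \<open>The two forbidden factors as a local condition on neighbouring letters.\<close>

definition compatible :: "letter \<Rightarrow> letter \<Rightarrow> bool" where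
  "compatible c d \<longleftrightarrow> \<not> (c = Close \<and> d = Open) \<and> \<not> (c = Open \<and> d = Close)"

lemma rb_word_iff: "rb_word w \<longleftrightarrow> balanced w \<and> successively compatible w"
proof -
  have s: "sublist [a, b] (c # w) \<longleftrightarrow> sublist [a, b] w \<or> c = a \<and> w \<noteq> [] \<and> hd w = b"
    for a b c :: letter and w
    by (cases w) (auto simp: sublist_Cons_right)
  have "successively compatible w \<longleftrightarrow> \<not> sublist [Close, Open] w \<and> \<not> sublist [Open, Close] w"
    by (induction w) (auto simp: s successively_Cons compatible_def)
  then show ?thesis by (auto simp: rb_word_def)
qed

section \<open>Run trees\<close>

text \<open>\<open>XRun a t\<close> is an x-run of length \<open>a\<close> followed by \<open>t\<close>; \<open>PRun b s t\<close> is a P-run of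
  length \<open>b\<close> with content \<open>s\<close> inside its innermost pair, followed by \<open>t\<close>.\<close>

datatype run_tree = End | XRun nat run_tree | PRun nat run_tree run_tree

fun word :: "run_tree \<Rightarrow> letter list" where
  "word End = []"
| "word (XRun a t) = replicate a X @ word t"
| "word (PRun b s t) = replicate b Open @ word s @ replicate b Close @ word t"

fun x_labels :: "run_tree \<Rightarrow> nat list" where
  "x_labels End = []"
| "x_labels (XRun a t) = a # x_labels t"
| "x_labels (PRun b s t) = x_labels s @ x_labels t"

fun p_labels :: "run_tree \<Rightarrow> nat list" where
  "p_labels End = []"
| "p_labels (XRun a t) = p_labels t"
| "p_labels (PRun b s t) = b # p_labels s @ p_labels t"

fun starts_x :: "run_tree \<Rightarrow> bool" where
  "starts_x (XRun a t) = True"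
| "starts_x _ = False"

fun starts_p :: "run_tree \<Rightarrow> bool" where
  "starts_p (PRun b s t) = True"
| "starts_p _ = False"

fun is_bracketed :: "run_tree \<Rightarrow> bool" where
  "is_bracketed (PRun b s End) = True"
| "is_bracketed _ = False"

text \<open>The content of a P-run is nonempty because \<open>P\<close> is never applied to the empty word, and not
  itself bracketed because the run would then be longer; neighbouring x-runs would merge, and
  neighbouring P-runs would meet in a closing bracket followed by an opening one.\<close>

fun reduced :: "run_tree \<Rightarrow> bool" where
  "reduced End \<longleftrightarrow> True"
| "reduced (XRun a t) \<longleftrightarrow> \<not> starts_x t \<and> reduced t"
| "reduced (PRun b s t) \<longleftrightarrow> s \<noteq> End \<and> \<not> is_bracketed s \<and> \<not> starts_p t \<and> reduced s \<and> reduced t"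

definition valid :: "run_tree \<Rightarrow> bool" where
  "valid t \<longleftrightarrow> reduced t \<and> (\<forall>a\<in>set (x_labels t). 0 < a) \<and> (\<forall>b\<in>set (p_labels t). 0 < b)"

text \<open>Prefixing a letter, or a bracketed word, to the word of a tree: the new letter or pair joins
  the run next to it if there is one. Every valid nonempty tree arises in this way, which
  turns the first-letter decomposition of balanced words into an induction on trees.\<close>

fun x_cons :: "run_tree \<Rightarrow> run_tree" where
  "x_cons (XRun a t) = XRun (Suc a) t"
| "x_cons t = XRun 1 t"

fun p_cons :: "run_tree \<Rightarrow> run_tree \<Rightarrow> run_tree" where
  "p_cons (PRun b s End) t = PRun (Suc b) s t"
| "p_cons s t = PRun 1 s t"

lemma word_x_cons [simp]: "word (x_cons t) = X # word t"
  by (cases t) auto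

lemma word_p_cons [simp]: "word (p_cons s t) = Open # word s @ Close # word t"
  by (cases "(s, t)" rule: p_cons.cases) (auto simp: replicate_app_Cons_same)

lemma valid_End [simp]: "valid End"
  by (simp add: valid_def)

lemma valid_x_cons: "valid t \<Longrightarrow> valid (x_cons t)"
  by (cases t) (auto simp: valid_def)

lemma valid_p_cons:
  "valid s \<Longrightarrow> valid t \<Longrightarrow> s \<noteq> End \<Longrightarrow> \<not> starts_p t \<Longrightarrow> valid (p_cons s t)"
  by (cases "(s, t)" rule: p_cons.cases) (auto simp: valid_def)

lemma p_cons_not_bracketed: "\<not> is_bracketed s \<Longrightarrow> p_cons s t = PRun 1 s t"
  by (cases "(s, t)" rule: p_cons.cases) auto

lemma x_cons_not_starts_x: "\<not> starts_x t \<Longrightarrow> x_cons t = XRun 1 t"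
  by (cases t) auto

lemma valid_cases:
  assumes "valid t"
  obtains "t = End"
  | t' where "valid t'" "t = x_cons t'"
  | s t' where "valid s" "valid t'" "s \<noteq> End" "\<not> starts_p t'" "t = p_cons s t'"
proof (cases t)
  case End
  then show ?thesis using that by blast
next
  case (XRun a t')
  then obtain a' where a: "a = Suc a'" using assms by (cases a) (auto simp: valid_def)
  show ?thesis
  proof (cases "a' = 0")
    case True
    then have "t = x_cons t'" "valid t'"
      using XRun a assms by (auto simp: valid_def x_cons_not_starts_x)
    then show ?thesis using that by blast
  next
    case False
    then have "t = x_cons (XRun a' t')" "valid (XRun a' t')"
      using XRun a assms by (auto simp: valid_def)
    then show ?thesis using that by blast
  qed
next
  case (PRun b s t')
  then obtain b' where b: "b = Suc b'" using assms by (cases b) (auto simp: valid_def)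
  have t': "valid t'" "\<not> starts_p t'" using PRun assms by (auto simp: valid_def)
  show ?thesis
  proof (cases "b' = 0")
    case True
    then have "t = p_cons s t'" "valid s" "s \<noteq> End"
      using PRun b assms by (auto simp: valid_def p_cons_not_bracketed)
    then show ?thesis using that t' by blast
  next
    case False
    then have "t = p_cons (PRun b' s End) t'" "valid (PRun b' s End)"
      using PRun b assms by (auto simp: valid_def)
    then show ?thesis using that t' by blast
  qed
qed

lemma valid_induct [consumes 1, case_names End X P]:
  assumes "valid t"
    and "Q End"
    and "\<And>t. valid t \<Longrightarrow> Q t \<Longrightarrow> Q (x_cons t)"
    and "\<And>s t. valid s \<Longrightarrow> valid t \<Longrightarrow> s \<noteq> End \<Longrightarrow> \<not> starts_p t \<Longrightarrow> Q s \<Longrightarrow> Q t \<Longrightarrow> Q (p_cons s t)"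
  shows "Q t"
  using assms(1)
proof (induction "length (word t)" arbitrary: t rule: less_induct)
  case less
  from less.prems show ?case
  proof (cases rule: valid_cases)
    case 1
    then show ?thesis using assms(2) by simp
  next
    case (2 t')
    then show ?thesis using less.hyps[of t'] assms(3) by simp
  next
    case (3 s t')
    then show ?thesis using less.hyps[of s] less.hyps[of t'] assms(4) by simp
  qed
qed

section \<open>Run trees and Rota-Baxter words correspond\<close>

lemma word_eq_Nil: "valid t \<Longrightarrow> word t = [] \<longleftrightarrow> t = End"
  by (cases t) (auto simp: valid_def)

lemma balanced_word: "balanced (word t)"
proof (induction t)
  case (XRun a t)
  then show ?case by (induction a) (auto simp: balanced_X)
next
  case (PRun b s t)
  then show ?case using balanced_append balanced_replicate
    by (metis append.assoc word.simps(3))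
qed simp

lemma starts_p_iff: "valid t \<Longrightarrow> starts_p t \<longleftrightarrow> (\<exists>w. word t = Open # w)"
  by (cases t) (auto simp: valid_def Cons_replicate_eq gr0_conv_Suc)

lemma rb_word_word: "valid t \<Longrightarrow> rb_word (word t)"
proof -
  assume "valid t"
  then have "successively compatible (word t)"
  proof (induction rule: valid_induct)
    case (X t)
    then show ?case by (auto simp: successively_Cons compatible_def)
  next
    case (P s t)
    have ne: "word s \<noteq> []" using P word_eq_Nil by blast
    have "hd (word s) \<noteq> Close"
      using ne balanced_word[of s] not_balanced_Close by (metis list.collapse)
    moreover have "last (word s) \<noteq> Open"
      using ne balanced_word[of s] not_balanced_Open_last by (metis append_butlast_last_id)
    moreover have "hd (word t) \<noteq> Open" if "word t \<noteq> []"
      using P starts_p_iff that by (metis list.collapse)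
    ultimately show ?case using P ne
      by (auto simp: successively_Cons successively_append_iff compatible_def)
  qed simp
  then show ?thesis using balanced_word by (simp add: rb_word_iff)
qed

text \<open>The forbidden factor of an opening and a closing bracket makes the content of a bracket nonempty,
  the other forbidden factor keeps a bracket from following it, so the tree for the content and
  the tree for the remainder satisfy the conditions for being combined by \<open>p_cons\<close>.\<close>

lemma rb_word_has_tree:
  assumes "rb_word w"
  shows "\<exists>t. valid t \<and> word t = w"
proof -
  have "balanced w" "successively compatible w" using assms by (auto simp: rb_word_iff)
  then show ?thesis
  proof (induction rule: balanced_induct)
    case Nil
    then show ?case by (intro exI[of _ End]) simp
  next
    case (X w)
    then have "successively compatible w" by (auto simp: successively_Cons)
    with X obtain t where "valid t" "word t = w" by blast
    then show ?case using valid_x_cons by (intro exI[of _ "x_cons t"]) auto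
  next
    case (Bracket z w)
    then have "successively compatible z" "successively compatible w" "z \<noteq> []"
      and w: "w \<noteq> [] \<Longrightarrow> hd w \<noteq> Open"
      by (auto simp: successively_Cons successively_append_iff compatible_def)
    with Bracket obtain s t where st: "valid s" "word s = z" "valid t" "word t = w" by blast
    have "s \<noteq> End" using st \<open>z \<noteq> []\<close> by auto
    moreover have "\<not> starts_p t" using st starts_p_iff w by auto
    ultimately show ?case using st valid_p_cons by (intro exI[of _ "p_cons s t"]) auto
  qed
qed

text \<open>The first letter of a word tells whether its tree is a result of \<open>x_cons\<close> or of \<open>p_cons\<close>, and
  the position of the first closing partner determines the words of the constituents.\<close>

lemma word_inj: "inj_on word {t. valid t}"
proof -
  have "t = t'" if "valid t" "valid t'" "word t = word t'" for t t'
    using that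
  proof (induction arbitrary: t' rule: valid_induct)
    case End
    then show ?case by (metis word_eq_Nil word.simps(1))
  next
    case (X t)
    from X.prems(1) show ?case
    proof (cases rule: valid_cases)
      case (2 t1)
      then show ?thesis using X by auto
    qed (use X in auto)
  next
    case (P s t)
    from P.prems(1) show ?case
    proof (cases rule: valid_cases)
      case (3 s1 t1)
      then have "word s = word s1" "word t = word t1"
        using P.prems(2) close_position_unique[OF _ balanced_word balanced_word] by auto
      then show ?thesis using P 3 by blast
    qed (use P in auto)
  qed
  then show ?thesis by (auto intro: inj_onI)
qed

section \<open>The labels are the lengths of the runs\<close>

lemma count_list_replicate: "count_list (replicate k c) d = (if c = d then k else 0)"
  by (induction k) auto

lemma degree_word: "degree (word t) = sum_list (p_labels t)"
proof -
  have "count_list (word t) Open = sum_list (p_labels t)"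
    by (induction t) (auto simp: count_list_replicate)
  then show ?thesis using degree_eq_count_Open balanced_word by simp
qed

lemma arity_word: "arity (word t) = sum_list (x_labels t)"
  unfolding arity_def by (induction t) (auto simp: count_list_replicate)

lemma nestedI: "balanced z \<Longrightarrow> w = p @ replicate k Open @ z @ replicate k Close @ s \<Longrightarrow> nested w k"
  unfolding nested_def by blast

lemma nested_append:
  assumes "nested w k"
  shows "nested (p @ w @ s) k"
proof -
  obtain p' z s' where "balanced z" "w = p' @ replicate k Open @ z @ replicate k Close @ s'"
    using assms by (auto simp: nested_def)
  then show ?thesis by (intro nestedI[of z _ "p @ p'" k "s' @ s"]) auto
qed

lemma nested_p_label: "b \<in> set (p_labels t) \<Longrightarrow> nested (word t) b"
proof (induction t)
  case (XRun a t)
  then show ?case using nested_append[of "word t" b "replicate a X" "[]"] by simp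
next
  case (PRun c s t)
  then consider "b = c" | "nested (word s) b" | "nested (word t) b" by auto
  then show ?case
  proof cases
    case 1
    then show ?thesis using nestedI[of "word s" _ "[]" c "word t"] balanced_word by simp
  next
    case 2
    then show ?thesis
      using nested_append[of "word s" b "replicate c Open" "replicate c Close @ word t"] by simp
  next
    case 3
    then show ?thesis
      using nested_append[of "word t" b "replicate c Open @ word s @ replicate c Close" "[]"]
      by simp
  qed
qed simp

text \<open>When the content of a bracket is again bracketed \<open>j + 1\<close> times, its tree is one single P-run; the
  outer pair then lengthens this run by one.\<close>

lemma bracketed_word:
  assumes "valid s" "word s = replicate (Suc j) Open @ z @ replicate (Suc j) Close" "balanced z"
  shows "\<exists>b s'. s = PRun b s' End \<and> Suc j \<le> b"
  using assms(1,2)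
proof (induction j arbitrary: s)
  case (0 s)
  from 0(1) show ?case
  proof (cases rule: valid_cases)
    case (3 s1 t1)
    then have "word s1 = z \<and> word t1 = []"
      using 0 assms(3) by (intro close_position_unique balanced_word) auto
    then have "t1 = End" using 3 word_eq_Nil by blast
    then show ?thesis using 3 by (cases "(s1, t1)" rule: p_cons.cases) auto
  qed (use 0 in auto)
next
  case (Suc j s)
  from Suc.prems(1) show ?case
  proof (cases rule: valid_cases)
    case (3 s1 t1)
    let ?z = "replicate (Suc j) Open @ z @ replicate (Suc j) Close"
    have "word s1 = ?z \<and> word t1 = []"
      using Suc.prems 3 assms(3)
      by (intro close_position_unique balanced_word balanced_replicate)
        (auto simp: replicate_app_Cons_same)
    moreover from this have "t1 = End" using 3 word_eq_Nil by blast
    moreover obtain b s' where "s1 = PRun b s' End" "Suc j \<le> b"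
      using Suc.IH 3 calculation by blast
    ultimately show ?thesis using 3 by auto
  qed (use Suc in auto)
qed

text \<open>A chain in a bracketed word followed by another word starts with the outer pair, or lies
  within the bracket, or behind it: since \<open>z\<close> is balanced, a chain that starts within the bracket
  also ends there.\<close>

lemma nested_bracket_cases:
  assumes "nested (Open # z @ Close # w) (Suc k)" "balanced z"
  obtains y where "z = replicate k Open @ y @ replicate k Close" "balanced y"
  | "nested z (Suc k)" | "nested w (Suc k)"
proof -
  obtain p y s where y: "balanced y"
    "Open # z @ Close # w = p @ replicate (Suc k) Open @ y @ replicate (Suc k) Close @ s"
    using assms(1) by (auto simp: nested_def)
  define m where "m = replicate k Open @ y @ replicate k Close"
  have m: "balanced m" unfolding m_def using y(1) balanced_replicate by blast
  have chain: "replicate (Suc k) Open @ y @ replicate (Suc k) Close @ r = Open # m @ Close # r" for r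
    by (simp add: m_def replicate_app_Cons_same)
  have eq: "Open # z @ Close # w = p @ Open # m @ Close # s" using y(2) chain by simp
  show ?thesis
  proof (cases p)
    case Nil
    then have "z = m" using eq close_position_unique[of z w m s] m assms(2) by simp
    then show ?thesis using that(1) m_def y(1) by blast
  next
    case (Cons c p')
    then have "z @ Close # w = p' @ Open # m @ Close # s" using eq by simp
    then obtain us where
      "z = p' @ us \<and> us @ Close # w = Open # m @ Close # s \<or>
       z @ us = p' \<and> Close # w = us @ Open # m @ Close # s"
      by (auto simp: append_eq_append_conv2)
    then show ?thesis
    proof
      assume a: "z = p' @ us \<and> us @ Close # w = Open # m @ Close # s"
      then obtain us' where us: "us = Open # us'" "us' @ Close # w = m @ Close # s"
        by (cases us) auto
      have p': "count_list p' Close \<le> count_list p' Open"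
        using a assms(2) balanced_prefix by blast
      have total: "count_list z Open = count_list z Close" using assms(2) by (simp add: balanced_def)
      from us(2) obtain r where
        "us' = m @ r \<and> r @ Close # w = Close # s \<or> us' @ r = m \<and> Close # w = r @ Close # s"
        by (auto simp: append_eq_append_conv2)
      \<comment> \<open>In this case the closing bracket after \<open>z\<close> would lie within the chain or be the partner of its
        first bracket, so that \<open>z\<close> would contain an unmatched opening bracket.\<close>
      moreover have False if "m = us' @ r" for r
      proof -
        have "count_list us' Close \<le> count_list us' Open"
          using that m balanced_prefix by blast
        then show False using total p' a us by simp
      qed
      ultimately obtain r where "us' = m @ r" "r @ Close # w = Close # s" by metis
      then obtain r' where "us' = m @ Close # r'"
        using \<open>\<And>r. m = us' @ r \<Longrightarrow> False\<close> by (cases r) auto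
      then have "z = p' @ replicate (Suc k) Open @ y @ replicate (Suc k) Close @ r'"
        using a us chain[of r'] by simp
      then show ?thesis using that(2) nestedI y(1) by blast
    next
      assume "z @ us = p' \<and> Close # w = us @ Open # m @ Close # s"
      then obtain us' where "w = us' @ Open # m @ Close # s" by (cases us) auto
      then have "w = us' @ replicate (Suc k) Open @ y @ replicate (Suc k) Close @ s"
        using chain[of s] by simp
      then show ?thesis using that(3) nestedI y(1) by blast
    qed
  qed
qed

lemma p_labels_x_cons [simp]: "p_labels (x_cons t) = p_labels t"
  by (cases t) auto

text \<open>A new pair around \<open>s\<close> may lengthen the P-run at the root of \<open>s\<close>, so labels persist only up to
  an increase.\<close>

lemma p_labels_p_cons:
  "b \<in> set (p_labels s) \<union> set (p_labels t) \<Longrightarrow> \<exists>b'\<in>set (p_labels (p_cons s t)). b \<le> b'"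
  by (cases "(s, t)" rule: p_cons.cases) (auto intro: le_SucI)

text \<open>Conversely to \<open>nested_p_label\<close>: every chain fits into some P-run of the tree.\<close>

lemma nested_le_p_label:
  "valid t \<Longrightarrow> nested (word t) (Suc k) \<Longrightarrow> \<exists>b\<in>set (p_labels t). Suc k \<le> b"
proof (induction arbitrary: k rule: valid_induct)
  case End
  then show ?case by (simp add: nested_def)
next
  case (X t)
  then have "nested (word t) (Suc k)" by (auto simp: nested_def Cons_eq_append_conv)
  then show ?case using X by simp
next
  case (P s t)
  from P.prems have "nested (Open # word s @ Close # word t) (Suc k)" by simp
  then show ?case using balanced_word[of s]
  proof (cases rule: nested_bracket_cases)
    case (1 y)
    show ?thesis
    proof (cases k)
      case 0
      then show ?thesis by (cases "(s, t)" rule: p_cons.cases) auto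
    next
      case (Suc j)
      then obtain b s' where "s = PRun b s' End" "Suc j \<le> b"
        using bracketed_word 1 P by blast
      then show ?thesis using Suc by auto
    qed
  next
    case 2
    then show ?thesis using P p_labels_p_cons by (meson UnCI order_trans)
  next
    case 3
    then show ?thesis using P p_labels_p_cons by (meson UnCI order_trans)
  qed
qed

text \<open>A block of equal letters cannot cross a boundary at which one of the neighbours differs.\<close>

lemma sublist_replicate_append:
  assumes "sublist (replicate k c) (a @ b)" "a = [] \<or> last a \<noteq> c \<or> b = [] \<or> hd b \<noteq> c"
  shows "sublist (replicate k c) a \<or> sublist (replicate k c) b"
proof -
  consider "sublist (replicate k c) a" | "sublist (replicate k c) b"
    | u v where "replicate k c = u @ v" "suffix u a" "prefix v b"
    using assms(1) by (auto simp: sublist_append)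
  then show ?thesis
  proof cases
    case (3 u v)
    then have in_c: "set u \<subseteq> {c}" "set v \<subseteq> {c}"
      by (metis Un_subset_iff set_append set_replicate_conv_if empty_subsetI subset_refl)+
    have "u = [] \<or> v = []"
    proof (rule ccontr)
      assume n: "\<not> (u = [] \<or> v = [])"
      then have "a \<noteq> []" "b \<noteq> []" "last a = last u" "hd b = hd v"
        using 3 by (auto simp: suffix_def prefix_def)
      moreover have "last u = c" "hd v = c"
        using in_c n last_in_set hd_in_set by blast+
      ultimately show False using assms(2) by auto
    qed
    then show ?thesis using 3 by auto
  qed auto
qed

lemma sublist_replicate_replicate:
  "sublist (replicate k c) (replicate b d) \<Longrightarrow> 0 < k \<Longrightarrow> c = d \<and> k \<le> b"
  by (metis in_set_replicate length_replicate neq0_conv set_mono_sublist sublist_length_le subsetD)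

lemma sublist_le_x_label:
  "valid t \<Longrightarrow> sublist (replicate k X) (word t) \<Longrightarrow> 0 < k \<Longrightarrow> \<exists>a\<in>set (x_labels t). k \<le> a"
proof (induction t)
  case End
  then show ?case by simp
next
  case (XRun a t)
  have v: "valid t" using XRun.prems by (auto simp: valid_def)
  have "word t = [] \<or> hd (word t) \<noteq> X"
    using XRun.prems by (cases t) (auto simp: valid_def gr0_conv_Suc)
  then have "sublist (replicate k X) (replicate a X) \<or> sublist (replicate k X) (word t)"
    using XRun.prems sublist_replicate_append[of k X "replicate a X" "word t"] by auto
  then show ?case using XRun v sublist_replicate_replicate by force
next
  case (PRun b s t)
  have v: "valid s" "valid t" "0 < b" using PRun.prems by (auto simp: valid_def)
  have no: "\<not> sublist (replicate k X) (replicate b Open)"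
    "\<not> sublist (replicate k X) (replicate b Close)"
    using PRun.prems(3) sublist_replicate_replicate[of k X b] by auto
  have "sublist (replicate k X) (replicate b Open) \<or>
      sublist (replicate k X) (word s @ replicate b Close @ word t)"
    using PRun.prems(2) v(3) by (intro sublist_replicate_append) simp_all
  then have "sublist (replicate k X) (word s) \<or>
      sublist (replicate k X) (replicate b Close @ word t)"
    using no v(3) sublist_replicate_append[of k X "word s" "replicate b Close @ word t"]
    by (simp add: hd_append)
  moreover have "sublist (replicate k X) (word t)"
    if "sublist (replicate k X) (replicate b Close @ word t)"
    using sublist_replicate_append[OF that] no v(3) by simp
  ultimately consider "sublist (replicate k X) (word s)" | "sublist (replicate k X) (word t)"
    by blast
  then show ?case
  proof cases
    case 1
    then show ?thesis using PRun.IH(1) v PRun.prems(3) by auto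
  next
    case 2
    then show ?thesis using PRun.IH(2) v PRun.prems(3) by auto
  qed
qed

lemma sublist_x_label: "a \<in> set (x_labels t) \<Longrightarrow> sublist (replicate a X) (word t)"
  by (induction t) (auto simp: sublist_append)

lemma word_in_RB_iff:
  assumes "valid t"
  shows "word t \<in> RB u v \<longleftrightarrow>
    (\<forall>b\<in>set (p_labels t). enat b \<le> u) \<and> (\<forall>a\<in>set (x_labels t). enat a \<le> v)"
proof -
  have "(\<forall>k>0. nested (word t) k \<longrightarrow> enat k \<le> u) \<longleftrightarrow> (\<forall>b\<in>set (p_labels t). enat b \<le> u)"
    using nested_p_label nested_le_p_label[OF assms] assms unfolding valid_def
    by (metis enat_ord_simps(1) gr0_conv_Suc order_trans)
  moreover have "(\<forall>k>0. sublist (replicate k X) (word t) \<longrightarrow> enat k \<le> v) \<longleftrightarrow>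
      (\<forall>a\<in>set (x_labels t). enat a \<le> v)"
    using sublist_x_label sublist_le_x_label[OF assms] assms unfolding valid_def
    by (metis enat_ord_simps(1) order_trans)
  ultimately show ?thesis
    using rb_word_word[OF assms] unfolding RB_def
    by (simp only: mem_Collect_eq p_runs_bounded_iff x_runs_bounded_iff simp_thms)
qed

section \<open>Counting\<close>

definition compositions :: "nat \<Rightarrow> nat \<Rightarrow> enat \<Rightarrow> nat list set" where
  "compositions m l v = {a. length a = l \<and> sum_list a = m \<and> (\<forall>i\<in>set a. 0 < i \<and> enat i \<le> v)}"

lemma g_eq_card: "g m l v = card (compositions m l v)"
  by (simp add: g_def compositions_def)

lemma finite_compositions: "finite (compositions m l v)"
proof -
  have "compositions m l v \<subseteq> {a. set a \<subseteq> {..m} \<and> length a = l}"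
    by (auto simp: compositions_def member_le_sum_list)
  then show ?thesis using finite_lists_length_eq[of "{..m}" l] finite_subset by blast
qed

lemma sum_list_ge_length: "(\<forall>i\<in>set a. 0 < i) \<Longrightarrow> length a \<le> sum_list (a :: nat list)"
  by (induction a) auto

lemma all_ones:
  "(\<forall>i\<in>set a. i = 1) \<Longrightarrow> a = replicate (length a) (1::nat) \<and> sum_list a = length a"
  by (induction a) auto

lemma compositions_one_iff: "a \<in> compositions m l 1 \<longleftrightarrow> a = replicate l 1 \<and> m = l"
proof
  assume a: "a \<in> compositions m l 1"
  then have "\<forall>i\<in>set a. i = 1" by (auto simp: compositions_def one_enat_def le_antisym)
  then show "a = replicate l 1 \<and> m = l" using all_ones a by (auto simp: compositions_def)
next
  assume "a = replicate l 1 \<and> m = l"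
  then show "a \<in> compositions m l 1"
    by (auto simp: compositions_def sum_list_replicate one_enat_def)
qed

lemma g_one: "g m l 1 = (if m = l then 1 else 0)"
proof -
  have "compositions m l 1 = (if m = l then {replicate l 1} else {})"
    by (auto simp: compositions_one_iff)
  then show ?thesis by (simp add: g_eq_card)
qed

text \<open>The membership in \<open>compositions\<close> says here that the labels are positive and bounded and have
  the prescribed sum; the number of parts is arbitrary.\<close>

definition run_trees :: "enat \<Rightarrow> enat \<Rightarrow> nat \<Rightarrow> nat \<Rightarrow> run_tree set" where
  "run_trees u v n m = {t. reduced t \<and>
     p_labels t \<in> compositions n (length (p_labels t)) u \<and>
     x_labels t \<in> compositions m (length (x_labels t)) v}"

lemma word_run_trees: "bij_betw word (run_trees u v n m) {w \<in> RB u v. degree w = n \<and> arity w = m}"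
proof -
  have t: "t \<in> run_trees u v n m \<longleftrightarrow>
      valid t \<and> word t \<in> {w \<in> RB u v. degree w = n \<and> arity w = m}" for t
  proof (cases "valid t")
    case True
    then show ?thesis using word_in_RB_iff[OF True, of u v] True
      by (auto simp: run_trees_def compositions_def valid_def degree_word arity_word)
  qed (auto simp: run_trees_def compositions_def valid_def)
  then have "inj_on word (run_trees u v n m)" using inj_on_subset[OF word_inj] by blast
  moreover have "word ` run_trees u v n m = {w \<in> RB u v. degree w = n \<and> arity w = m}"
  proof
    show "word ` run_trees u v n m \<subseteq> {w \<in> RB u v. degree w = n \<and> arity w = m}" using t by blast
    show "{w \<in> RB u v. degree w = n \<and> arity w = m} \<subseteq> word ` run_trees u v n m"
    proof
      fix w assume w: "w \<in> {w \<in> RB u v. degree w = n \<and> arity w = m}"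
      then have "rb_word w" by (simp add: RB_def)
      then obtain t' where "valid t'" "word t' = w" using rb_word_has_tree by blast
      then show "w \<in> word ` run_trees u v n m" using w t by blast
    qed
  qed
  ultimately show ?thesis by (simp add: bij_betw_def)
qed

lemma r_eq_card: "r u v n m = card (run_trees u v n m)"
  unfolding r_def by (rule bij_betw_same_card[OF word_run_trees, symmetric])

lemma finite_run_trees: "finite (run_trees u v n m)"
proof -
  have "finite {w. set w \<subseteq> {X, Open, Close} \<and> length w = 2 * n + m}"
    by (rule finite_lists_length_eq) simp
  moreover have "word ` run_trees u v n m \<subseteq> {w. set w \<subseteq> {X, Open, Close} \<and> length w = 2 * n + m}"
  proof -
    have "length (word t) = 2 * sum_list (p_labels t) + sum_list (x_labels t)" for t
      by (induction t) auto
    moreover have "c \<in> {X, Open, Close}" for c by (cases c) auto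
    ultimately show ?thesis by (auto simp: run_trees_def compositions_def)
  qed
  ultimately have "finite (word ` run_trees u v n m)" using finite_subset by blast
  then show ?thesis using word_run_trees finite_imageD bij_betw_def by blast
qed

text \<open>Forgetting the run lengths amounts to replacing each run by a run of length one.\<close>

fun skeleton :: "run_tree \<Rightarrow> run_tree" where
  "skeleton End = End"
| "skeleton (XRun a t) = XRun 1 (skeleton t)"
| "skeleton (PRun b s t) = PRun 1 (skeleton s) (skeleton t)"

lemma reduced_skeleton [simp]: "reduced (skeleton t) = reduced t"
proof -
  have sx: "starts_x (skeleton t) = starts_x t" for t by (cases t) auto
  have sp: "starts_p (skeleton t) = starts_p t" for t by (cases t) auto
  have se: "skeleton t = End \<longleftrightarrow> t = End" for t by (cases t) auto
  have sb: "is_bracketed (skeleton t) = is_bracketed t" for t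
    by (cases t rule: is_bracketed.cases) auto
  show ?thesis by (induction t) (auto simp: sx sp sb se)
qed

lemma p_labels_skeleton [simp]: "p_labels (skeleton t) = replicate (length (p_labels t)) 1"
  by (induction t) (auto simp: replicate_add)

lemma x_labels_skeleton [simp]: "x_labels (skeleton t) = replicate (length (x_labels t)) 1"
  by (induction t) (auto simp: replicate_add)

lemma run_tree_eqI:
  "skeleton t = skeleton t' \<Longrightarrow> p_labels t = p_labels t' \<Longrightarrow> x_labels t = x_labels t' \<Longrightarrow> t = t'"
proof (induction t arbitrary: t')
  case End
  then show ?case by (cases t') auto
next
  case (XRun a t)
  then show ?case by (cases t') auto
next
  case (PRun b s t)
  then obtain b' s1 t1 where t': "t' = PRun b' s1 t1" by (cases t') auto
  then have sk: "skeleton s = skeleton s1" "skeleton t = skeleton t1" using PRun.prems by auto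
  then have "length (p_labels s) = length (p_labels s1)" "length (x_labels s) = length (x_labels s1)"
    by (metis length_replicate p_labels_skeleton, metis length_replicate x_labels_skeleton)
  then show ?case using PRun t' sk by auto
qed

lemma relabelling_exists:
  "length bs = length (p_labels t) \<Longrightarrow> length as = length (x_labels t) \<Longrightarrow>
    \<exists>t'. skeleton t' = skeleton t \<and> p_labels t' = bs \<and> x_labels t' = as"
proof (induction t arbitrary: as bs)
  case End
  then show ?case by (intro exI[of _ End]) auto
next
  case (XRun a t)
  then obtain a' as' where as: "as = a' # as'" "length as' = length (x_labels t)"
    by (cases as) auto
  with XRun obtain t' where "skeleton t' = skeleton t \<and> p_labels t' = bs \<and> x_labels t' = as'"
    by auto
  then show ?case using as by (intro exI[of _ "XRun a' t'"]) auto
next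
  case (PRun b s t)
  then obtain b' bs' where bs: "bs = b' # bs'"
    "length bs' = length (p_labels s) + length (p_labels t)"
    by (cases bs) auto
  obtain s' where s': "skeleton s' = skeleton s" "p_labels s' = take (length (p_labels s)) bs'"
    "x_labels s' = take (length (x_labels s)) as"
    using PRun.IH(1)[of "take (length (p_labels s)) bs'" "take (length (x_labels s)) as"]
      bs PRun.prems by auto
  obtain t' where t': "skeleton t' = skeleton t" "p_labels t' = drop (length (p_labels s)) bs'"
    "x_labels t' = drop (length (x_labels s)) as"
    using PRun.IH(2)[of "drop (length (p_labels s)) bs'" "drop (length (x_labels s)) as"]
      bs PRun.prems by auto
  show ?case using s' t' bs by (intro exI[of _ "PRun b' s' t'"]) auto
qed

lemma skeleton_idem [simp]: "skeleton (skeleton t) = skeleton t"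
  by (induction t) auto

lemma run_trees_one_iff:
  "t \<in> run_trees 1 1 k l \<longleftrightarrow>
    reduced t \<and> skeleton t = t \<and> length (p_labels t) = k \<and> length (x_labels t) = l"
proof -
  have "skeleton t = t \<longleftrightarrow>
      p_labels t = replicate (length (p_labels t)) 1 \<and> x_labels t = replicate (length (x_labels t)) 1"
    using run_tree_eqI[of "skeleton t" t]
    by (metis length_replicate p_labels_skeleton x_labels_skeleton skeleton_idem)
  then show ?thesis unfolding run_trees_def by (auto simp: compositions_one_iff)
qed

text \<open>A tree is determined by its skeleton and its two lists of labels, which are compositions of
  the degree and the arity and may be chosen independently of each other.\<close>

lemma r_eq_double_sum:
  assumes "0 < n" "0 < m"
  shows "r u v n m = (\<Sum>k=1..n. \<Sum>l=1..m. g n k u * g m l v * r 1 1 k l)"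
proof -
  let ?D = "SIGMA (k, l):{1..n} \<times> {1..m}. run_trees 1 1 k l \<times> compositions n k u \<times> compositions m l v"
  let ?f = "\<lambda>t. ((length (p_labels t), length (x_labels t)), skeleton t, p_labels t, x_labels t)"
  have "bij_betw ?f (run_trees u v n m) ?D"
    unfolding bij_betw_def
  proof
    show "inj_on ?f (run_trees u v n m)" by (rule inj_onI) (auto intro: run_tree_eqI)
    show "?f ` run_trees u v n m = ?D"
    proof
      show "?f ` run_trees u v n m \<subseteq> ?D"
      proof
        fix y assume "y \<in> ?f ` run_trees u v n m"
        then obtain t where t: "t \<in> run_trees u v n m" "y = ?f t" by blast
        have c: "p_labels t \<in> compositions n (length (p_labels t)) u"
          "x_labels t \<in> compositions m (length (x_labels t)) v" "reduced t"
          using t by (auto simp: run_trees_def)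
        have "1 \<le> length (p_labels t)" "1 \<le> length (x_labels t)"
          using c assms by (auto simp: compositions_def Suc_le_eq)
        moreover have "length (p_labels t) \<le> n" "length (x_labels t) \<le> m"
          using c sum_list_ge_length by (auto simp: compositions_def)
        ultimately show "y \<in> ?D" using c t(2) by (auto simp: run_trees_one_iff)
      qed
      show "?D \<subseteq> ?f ` run_trees u v n m"
      proof
        fix y assume "y \<in> ?D"
        then obtain k l s bs as where y: "y = ((k, l), s, bs, as)" "s \<in> run_trees 1 1 k l"
          "bs \<in> compositions n k u" "as \<in> compositions m l v" by auto
        then obtain t where t: "skeleton t = s" "p_labels t = bs" "x_labels t = as"
          using relabelling_exists[of bs s as] by (auto simp: run_trees_one_iff compositions_def)
        have "reduced t" using t y(2) by (auto simp: run_trees_one_iff)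
        then have "t \<in> run_trees u v n m" using y t by (auto simp: run_trees_def compositions_def)
        moreover have "y = ?f t" using y t by (auto simp: compositions_def)
        ultimately show "y \<in> ?f ` run_trees u v n m" by blast
      qed
    qed
  qed
  then have "r u v n m = card ?D" unfolding r_eq_card by (rule bij_betw_same_card)
  also have "\<dots> = (\<Sum>x\<in>{1..n} \<times> {1..m}.
      card (case x of (k, l) \<Rightarrow> run_trees 1 1 k l \<times> compositions n k u \<times> compositions m l v))"
    by (rule card_SigmaI) (auto simp: finite_run_trees finite_compositions)
  also have "\<dots> = (\<Sum>(k, l)\<in>{1..n} \<times> {1..m}. g n k u * g m l v * r 1 1 k l)"
    by (rule sum.cong) (auto simp: card_cartesian_product r_eq_card g_eq_card)
  finally show ?thesis by (simp add: sum.cartesian_product)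
qed

lemma sum_g_one:
  assumes "0 < n"
  shows "(\<Sum>k=1..n. g n k 1 * f k) = f n"
proof -
  have "(\<Sum>k=1..n. g n k 1 * f k) = (\<Sum>k=1..n. if k = n then f k else 0)"
    by (rule sum.cong) (auto simp: g_one)
  then show ?thesis using assms by simp
qed

lemma r_one_right:
  assumes "0 < n" "0 < m"
  shows "r u 1 n m = (\<Sum>k=1..n. g n k u * r 1 1 k m)"
proof -
  have "r u 1 n m = (\<Sum>k=1..n. g n k u * (\<Sum>l=1..m. g m l 1 * r 1 1 k l))"
    using r_eq_double_sum[OF assms] by (simp add: sum_distrib_left mult.assoc)
  then show ?thesis using sum_g_one assms(2) by simp
qed

lemma r_one_left:
  assumes "0 < n" "0 < m"
  shows "r 1 v n m = (\<Sum>l=1..m. g m l v * r 1 1 n l)"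
proof -
  have "r 1 v n m = (\<Sum>k=1..n. g n k 1 * (\<Sum>l=1..m. g m l v * r 1 1 k l))"
    using r_eq_double_sum[OF assms] by (simp add: sum_distrib_left mult.assoc)
  then show ?thesis using sum_g_one assms(1) by simp
qed

theorem theorem4p2:
  fixes n m :: nat
  assumes "0 < n" and "0 < m"
  shows "(\<forall>u\<ge>1. r u 1 n m = (\<Sum>k=1..n. g n k u * r 1 1 k m)) \<and>
    (\<forall>v\<ge>1. r 1 v n m = (\<Sum>l=1..m. g m l v * r 1 1 n l)) \<and>
    (\<forall>u\<ge>1. \<forall>v\<ge>1.
        r u v n m = (\<Sum>l=1..m. g m l v * r u 1 n l) \<and>
        r u v n m = (\<Sum>k=1..n. g n k u * r 1 v k m) \<and>
        r u v n m = (\<Sum>k=1..n. \<Sum>l=1..m. g n k u * g m l v * r 1 1 k l))"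
proof -
  have a: "r u v n m = (\<Sum>l=1..m. g m l v * r u 1 n l)" for u v
  proof -
    have "(\<Sum>l=1..m. g m l v * r u 1 n l) =
        (\<Sum>l=1..m. \<Sum>k=1..n. g n k u * g m l v * r 1 1 k l)"
    proof (rule sum.cong)
      fix l assume "l \<in> {1..m}"
      then have "r u 1 n l = (\<Sum>k=1..n. g n k u * r 1 1 k l)"
        using r_one_right assms(1) by simp
      then show "g m l v * r u 1 n l = (\<Sum>k=1..n. g n k u * g m l v * r 1 1 k l)"
        by (simp only: sum_distrib_left ac_simps)
    qed simp
    also have "\<dots> = (\<Sum>k=1..n. \<Sum>l=1..m. g n k u * g m l v * r 1 1 k l)" by (rule sum.swap)
    finally show ?thesis using r_eq_double_sum[OF assms] by (simp only:)
  qed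
  have b: "r u v n m = (\<Sum>k=1..n. g n k u * r 1 v k m)" for u v
  proof -
    have "(\<Sum>k=1..n. g n k u * r 1 v k m) =
        (\<Sum>k=1..n. \<Sum>l=1..m. g n k u * g m l v * r 1 1 k l)"
    proof (rule sum.cong)
      fix k assume "k \<in> {1..n}"
      then have "r 1 v k m = (\<Sum>l=1..m. g m l v * r 1 1 k l)"
        using r_one_left assms(2) by simp
      then show "g n k u * r 1 v k m = (\<Sum>l=1..m. g n k u * g m l v * r 1 1 k l)"
        by (simp only: sum_distrib_left ac_simps)
    qed simp
    then show ?thesis using r_eq_double_sum[OF assms] by (simp only:)
  qed
  show ?thesis using a b r_one_right[OF assms] r_one_left[OF assms] r_eq_double_sum[OF assms]
    by (intro conjI allI impI)
qed

end
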